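(* For all $n\ge2$ and $1\le k\le n$, the number of U-words $u$ of length $n$ with $u_{n-1}+u_n=k$ equals $E_{n,k}$.
   Context: $E_{n,k}$ is the number of permutations $\pi$ of $\{1,\dots,n\}$ with $\pi_1>\pi_2<\pi_3>\cdots$ and $\pi_1=k$. A U-word of length $n$ is a sequence $u=(u_1,\dots,u_n)$ of positive integers with $u_1=1$ and $u_i+u_{i-1}\le i$ for $2\le i\le n$. *)

theory Defs
  imports "HOL-Library.FuncSet" "HOL-Combinatorics.Permutations"
begin

definition down_up :: "nat \<Rightarrow> (nat \<Rightarrow> nat) \<Rightarrow> bool" where
  "down_up n \<pi> \<longleftrightarrow>
     (\<forall>i\<in>{1..<n}. if odd i then \<pi> i > \<pi> (i + 1) else \<pi> i < \<pi> (i + 1))"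

definition entringer :: "nat \<Rightarrow> nat \<Rightarrow> nat" where
  "entringer n k = card {\<pi>. \<pi> permutes {1..n} \<and> down_up n \<pi> \<and> \<pi> 1 = k}"

text \<open>Words of length \<open>n\<close> are functions on the positions \<open>{1..n}\<close>. They are taken to be
  extensional, so that two words are equal iff they have the same letters.\<close>

definition U_words :: "nat \<Rightarrow> (nat \<Rightarrow> nat) set" where
  "U_words n = {u \<in> {1..n} \<rightarrow>\<^sub>E {1..}. u 1 = 1 \<and> (\<forall>i\<in>{2..n}. u i + u (i - 1) \<le> i)}"

text \<open>Finiteness ensures that cardinalities of sets of U-words are genuine counts.\<close>

lemma finite_U_words: "finite (U_words n)"
proof (rule finite_subset)
  show "U_words n \<subseteq> {1..n} \<rightarrow>\<^sub>E {1..n}"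
  proof
    fix u assume u: "u \<in> U_words n"
    have "u i \<le> n" if "i \<in> {1..n}" for i
    proof (cases "i = 1")
      case True
      then show ?thesis using u that by (simp add: U_words_def)
    next
      case False
      then have "u i + u (i - 1) \<le> i"
        using u that by (simp add: U_words_def)
      then show ?thesis using that by simp
    qed
    then show "u \<in> {1..n} \<rightarrow>\<^sub>E {1..n}"
      using u by (auto simp: U_words_def PiE_iff)
  qed
qed (simp add: finite_PiE)

end

theory Submission
  imports Defs
begin

text \<open>Both families satisfy the Entringer recurrence: the objects of size \<open>n + 1\<close> with statistic
  \<open>k\<close> are in bijection with the objects of size \<open>n\<close> whose statistic exceeds \<open>n + 1 - k\<close>. For
  permutations one deletes the first entry, standardises and complements. For U-words one deletes
  the last letter and then applies to the new last letter \<open>u\<^sub>n\<close> the involution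
  \<open>u\<^sub>n \<mapsto> n + 1 - u\<^bsub>n-1\<^esub> - u\<^sub>n\<close>, which exchanges \<open>u\<^sub>n\<close> with \<open>n + 1 - (u\<^bsub>n-1\<^esub> + u\<^sub>n)\<close>.\<close>

section \<open>Permutations of finite sets and counting by a statistic\<close>

lemma permutes_finite_iff:
  assumes "finite A"
  shows "p permutes A \<longleftrightarrow> p \<in> A \<rightarrow> A \<and> inj_on p A \<and> (\<forall>x. x \<notin> A \<longrightarrow> p x = x)"
proof
  assume "p permutes A"
  then show "p \<in> A \<rightarrow> A \<and> inj_on p A \<and> (\<forall>x. x \<notin> A \<longrightarrow> p x = x)"
    by (auto simp: permutes_in_image permutes_inj_on permutes_not_in)
next
  assume *: "p \<in> A \<rightarrow> A \<and> inj_on p A \<and> (\<forall>x. x \<notin> A \<longrightarrow> p x = x)"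
  then have "p ` A = A"
    using assms by (intro endo_inj_surj) auto
  with * have "bij_betw p A A"
    by (simp add: bij_betw_def)
  with * show "p permutes A"
    by (auto intro: bij_imp_permutes)
qed

text \<open>Turns the bijections below, which produce objects whose statistic exceeds a bound, into
  sums over the values of the statistic; it serves permutations and words alike.\<close>

lemma card_greater_conv_sum:
  fixes f :: "'a \<Rightarrow> nat"
  assumes "finite X" and "\<And>x. x \<in> X \<Longrightarrow> f x \<le> n"
  shows "card {x \<in> X. m < f x} = (\<Sum>j\<in>{m<..n}. card {x \<in> X. f x = j})"
proof -
  have "{x \<in> X. m < f x} = (\<Union>j\<in>{m<..n}. {x \<in> X. f x = j})"
    using assms by auto
  then show ?thesis
    using assms by (simp add: card_UN_disjoint disjoint_iff)
qed

section \<open>The Entringer recurrence for down-up permutations\<close>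

definition down_up_perms :: "nat \<Rightarrow> (nat \<Rightarrow> nat) set" where
  "down_up_perms n = {\<pi>. \<pi> permutes {1..n} \<and> down_up n \<pi>}"

lemma finite_down_up_perms: "finite (down_up_perms n)"
  by (rule finite_subset[OF _ finite_permutations[of "{1..n}"]]) (auto simp: down_up_perms_def)

lemma entringer_alt: "entringer n k = card {\<pi> \<in> down_up_perms n. \<pi> 1 = k}"
  by (simp add: entringer_def down_up_perms_def)

text \<open>The inner conditional closes the gap left by the deleted value \<open>k\<close>;
  subtraction from \<open>Suc n\<close> is the complement. The identity outside
  \<open>{1..n}\<close> is what \<open>permutes\<close> demands.\<close>

definition remove_first :: "nat \<Rightarrow> nat \<Rightarrow> (nat \<Rightarrow> nat) \<Rightarrow> nat \<Rightarrow> nat" where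
  "remove_first n k \<pi> i =
     (if i \<in> {1..n} then Suc n - (if k < \<pi> (Suc i) then \<pi> (Suc i) - 1 else \<pi> (Suc i)) else i)"

text \<open>Undoes the steps in reverse order: complement first, then raise the values from
  \<open>k\<close> upwards to make room for \<open>k\<close>.\<close>

definition insert_first :: "nat \<Rightarrow> nat \<Rightarrow> (nat \<Rightarrow> nat) \<Rightarrow> nat \<Rightarrow> nat" where
  "insert_first n k \<sigma> i =
     (if i = 1 then k
      else if i \<in> {2..Suc n} then
        (if k \<le> Suc n - \<sigma> (i - 1) then Suc n - \<sigma> (i - 1) + 1 else Suc n - \<sigma> (i - 1))
      else i)"

text \<open>Deleting an entry at the front flips the parity of every position, and the complement
  flips every comparison, so the alternation pattern survives.\<close>

lemma remove_first_down_up: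
  assumes n: "1 \<le> n" and pi: "\<pi> \<in> down_up_perms (Suc n)" and k: "\<pi> 1 = k"
  shows "remove_first n k \<pi> \<in> down_up_perms n" "Suc n - k < remove_first n k \<pi> 1"
    "insert_first n k (remove_first n k \<pi>) = \<pi>"
proof -
  have p: "\<pi> permutes {1..Suc n}" and d: "down_up (Suc n) \<pi>"
    using pi by (auto simp: down_up_perms_def)
  have rng: "1 \<le> \<pi> i \<and> \<pi> i \<le> Suc n" if "1 \<le> i" "i \<le> Suc n" for i
    using permutes_in_image[OF p, of i] that by auto
  have inj: "\<pi> i = \<pi> j \<longleftrightarrow> i = j" for i j
    using permutes_inj[OF p] by (auto dest: injD)
  have ne: "\<pi> (Suc i) \<noteq> k" if "1 \<le> i" for i
    using inj[of "Suc i" 1] k that by auto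
  have krng: "1 \<le> k" "k \<le> Suc n"
    using rng[of 1] k by auto
  \<comment> \<open>Closing the gap is strictly increasing on values other than \<open>k\<close>, so
    the whole map reverses order. Injectivity and alternation both follow from this.\<close>
  have less: "remove_first n k \<pi> i < remove_first n k \<pi> j \<longleftrightarrow> \<pi> (Suc j) < \<pi> (Suc i)"
    if "i \<in> {1..n}" "j \<in> {1..n}" for i j
    using that rng[of "Suc i"] rng[of "Suc j"] ne[of i] ne[of j] krng
    by (auto simp: remove_first_def)
  have "remove_first n k \<pi> permutes {1..n}"
    unfolding permutes_finite_iff[OF finite_atLeastAtMost]
  proof (intro conjI allI impI)
    show "remove_first n k \<pi> \<in> {1..n} \<rightarrow> {1..n}"
    proof
      fix i assume "i \<in> {1..n}"
      then show "remove_first n k \<pi> i \<in> {1..n}"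
        using rng[of "Suc i"] ne[of i] krng by (auto simp: remove_first_def)
    qed
    show "inj_on (remove_first n k \<pi>) {1..n}"
    proof (rule inj_onI)
      fix i j assume ij: "i \<in> {1..n}" "j \<in> {1..n}" "remove_first n k \<pi> i = remove_first n k \<pi> j"
      then have "\<pi> (Suc i) = \<pi> (Suc j)"
        using less[of i j] less[of j i] by auto
      then show "i = j" by (simp add: inj)
    qed
  qed (auto simp: remove_first_def)
  moreover have "down_up n (remove_first n k \<pi>)"
    unfolding down_up_def
  proof
    fix i assume "i \<in> {1..<n}"
    then show "if odd i then remove_first n k \<pi> i > remove_first n k \<pi> (i + 1)
        else remove_first n k \<pi> i < remove_first n k \<pi> (i + 1)"
      using d[unfolded down_up_def, rule_format, of "Suc i"] less[of i "Suc i"] less[of "Suc i" i]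
      by auto
  qed
  ultimately show "remove_first n k \<pi> \<in> down_up_perms n"
    by (simp add: down_up_perms_def)
  \<comment> \<open>Being below \<open>k\<close>, the second entry is not lowered, and its
    complement exceeds \<open>Suc n - k\<close>.\<close>
  have "\<pi> 2 < k"
    using d[unfolded down_up_def, rule_format, of 1] n k by (simp add: numeral_2_eq_2)
  then show "Suc n - k < remove_first n k \<pi> 1"
    using n krng rng[of 2] by (auto simp: remove_first_def numeral_2_eq_2)
  show "insert_first n k (remove_first n k \<pi>) = \<pi>"
  proof
    fix i
    consider "i = 1" | "i \<in> {2..Suc n}" | "i \<notin> {1..Suc n}" by fastforce
    then show "insert_first n k (remove_first n k \<pi>) i = \<pi> i"
    proof cases
      case 2
      then have "Suc (i - 1) = i" "i - 1 \<in> {1..n}" by auto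
      with 2 show ?thesis
        using rng[of i] ne[of "i - 1"] krng by (auto simp: insert_first_def remove_first_def)
    qed (use k permutes_not_in[OF p] in \<open>auto simp: insert_first_def\<close>)
  qed
qed

text \<open>The bound on \<open>\<sigma> 1\<close> is needed exactly for the new initial descent: it
  says that the complement of \<open>\<sigma> 1\<close> lies below \<open>k\<close>, hence is not
  raised.\<close>

lemma insert_first_down_up:
  assumes n: "1 \<le> n" and krng: "1 \<le> k" "k \<le> Suc n"
    and sigma: "\<sigma> \<in> down_up_perms n" and gt: "Suc n - k < \<sigma> 1"
  shows "insert_first n k \<sigma> \<in> down_up_perms (Suc n)" "insert_first n k \<sigma> 1 = k"
    "remove_first n k (insert_first n k \<sigma>) = \<sigma>"
proof -
  have p: "\<sigma> permutes {1..n}" and d: "down_up n \<sigma>"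
    using sigma by (auto simp: down_up_perms_def)
  have rng: "1 \<le> \<sigma> i \<and> \<sigma> i \<le> n" if "1 \<le> i" "i \<le> n" for i
    using permutes_in_image[OF p, of i] that by auto
  have inj: "\<sigma> i = \<sigma> j \<longleftrightarrow> i = j" for i j
    using permutes_inj[OF p] by (auto dest: injD)
  show first: "insert_first n k \<sigma> 1 = k"
    by (simp add: insert_first_def)
  have ne: "insert_first n k \<sigma> i \<noteq> k" if "i \<in> {2..Suc n}" for i
    using that by (auto simp: insert_first_def)
  have less: "insert_first n k \<sigma> i < insert_first n k \<sigma> j \<longleftrightarrow> \<sigma> (j - 1) < \<sigma> (i - 1)"
    if ij: "i \<in> {2..Suc n}" "j \<in> {2..Suc n}" for i j
  proof -
    obtain i' j' where "i = Suc i'" "j = Suc j'" "i' \<in> {1..n}" "j' \<in> {1..n}"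
      using ij by (cases i; cases j) auto
    then show ?thesis
      using rng[of i'] rng[of j'] by (auto simp: insert_first_def)
  qed
  have "insert_first n k \<sigma> permutes {1..Suc n}"
    unfolding permutes_finite_iff[OF finite_atLeastAtMost]
  proof (intro conjI allI impI)
    show "insert_first n k \<sigma> \<in> {1..Suc n} \<rightarrow> {1..Suc n}"
    proof
      fix i assume "i \<in> {1..Suc n}"
      then consider "i = 1" | j where "i = Suc j" "j \<in> {1..n}" by (cases i) fastforce+
      then show "insert_first n k \<sigma> i \<in> {1..Suc n}"
      proof cases
        case 2
        then show ?thesis using rng[of j] by (auto simp: insert_first_def)
      qed (use krng in \<open>simp add: insert_first_def\<close>)
    qed
    show "inj_on (insert_first n k \<sigma>) {1..Suc n}"
    proof (rule inj_onI)
      fix i j assume ij: "i \<in> {1..Suc n}" "j \<in> {1..Suc n}"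
        "insert_first n k \<sigma> i = insert_first n k \<sigma> j"
      show "i = j"
      \<comment> \<open>By \<open>ne\<close> the value \<open>k\<close> occurs only at position 1;
        elsewhere order reversal separates the entries.\<close>
      proof (cases "i = 1 \<or> j = 1")
        case True
        then show ?thesis
          using ij first ne[of i] ne[of j] by (cases "i = 1"; cases "j = 1") auto
      next
        case False
        then have *: "i \<in> {2..Suc n}" "j \<in> {2..Suc n}" using ij by auto
        then have "\<sigma> (i - 1) = \<sigma> (j - 1)"
          using less[of i j] less[of j i] ij(3) by auto
        then show ?thesis using * by (auto simp: inj)
      qed
    qed
  qed (use n in \<open>auto simp: insert_first_def\<close>)
  moreover have "down_up (Suc n) (insert_first n k \<sigma>)"
    unfolding down_up_def
  proof
    fix i assume i: "i \<in> {1..<Suc n}"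
    show "if odd i then insert_first n k \<sigma> i > insert_first n k \<sigma> (i + 1)
        else insert_first n k \<sigma> i < insert_first n k \<sigma> (i + 1)"
    proof (cases "i = 1")
      case True
      then show ?thesis
        using gt n krng rng[of 1] by (auto simp: insert_first_def)
    next
      case False
      then obtain j where "i = Suc j" "j \<in> {1..<n}" using i by (cases i) auto
      then show ?thesis
        using d[unfolded down_up_def, rule_format, of j] less[of i "Suc i"] less[of "Suc i" i]
        by auto
    qed
  qed
  ultimately show "insert_first n k \<sigma> \<in> down_up_perms (Suc n)"
    by (simp add: down_up_perms_def)
  show "remove_first n k (insert_first n k \<sigma>) = \<sigma>"
  proof
    fix i
    show "remove_first n k (insert_first n k \<sigma>) i = \<sigma> i"
      using rng[of i] permutes_not_in[OF p, of i] krng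
      by (auto simp: insert_first_def remove_first_def)
  qed
qed

lemma entringer_Suc:
  assumes "1 \<le> n" and "1 \<le> k" and "k \<le> Suc n"
  shows "entringer (Suc n) k = card {\<sigma> \<in> down_up_perms n. Suc n - k < \<sigma> 1}"
  unfolding entringer_alt
  by (rule bij_betw_same_card[of "remove_first n k"],
      rule bij_betw_byWitness[where f' = "insert_first n k"])
    (use assms in \<open>auto simp del: One_nat_def simp: remove_first_down_up insert_first_down_up\<close>)

text \<open>Sorts the shorter permutations by their first entry, which is at most
  \<open>n\<close>.\<close>

lemma entringer_recurrence:
  assumes "1 \<le> n" and "1 \<le> k" and "k \<le> Suc n"
  shows "entringer (Suc n) k = (\<Sum>j\<in>{Suc n - k<..n}. entringer n j)"
proof -
  have le: "\<sigma> 1 \<le> n" if "\<sigma> \<in> down_up_perms n" for \<sigma>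
    using that permutes_in_image[of \<sigma> "{1..n}" 1] assms by (auto simp: down_up_perms_def)
  show ?thesis
    unfolding entringer_Suc[OF assms] unfolding entringer_alt
    by (rule card_greater_conv_sum[OF finite_down_up_perms le])
qed

section \<open>The same recurrence for U-words\<close>

lemma U_words_iff:
  "u \<in> U_words n \<longleftrightarrow> (\<forall>i\<in>{1..n}. 1 \<le> u i) \<and> (\<forall>i. i \<notin> {1..n} \<longrightarrow> u i = undefined) \<and>
     u 1 = 1 \<and> (\<forall>i\<in>{2..n}. u i + u (i - 1) \<le> i)"
  by (auto simp: U_words_def PiE_iff extensional_def)

lemma U_words_pos: "u \<in> U_words n \<Longrightarrow> 1 \<le> i \<Longrightarrow> i \<le> n \<Longrightarrow> 1 \<le> u i"
  by (simp add: U_words_iff)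

text \<open>For a U-word of length at least 2 with its other letters fixed, the admissible last
  letters form the interval \<open>{1..n - u (n - 1)}\<close>; this map reverses that
  interval.\<close>

definition reflect_last :: "nat \<Rightarrow> (nat \<Rightarrow> nat) \<Rightarrow> nat \<Rightarrow> nat" where
  "reflect_last n u = u(n := Suc n - (u (n - 1) + u n))"

lemma reflect_last_U_words:
  assumes n: "2 \<le> n" and u: "u \<in> U_words n"
  shows "reflect_last n u \<in> U_words n" "reflect_last n (reflect_last n u) = u"
    "reflect_last n u (n - 1) + reflect_last n u n = Suc n - u n"
proof -
  have sum: "u n + u (n - 1) \<le> n" and "1 \<le> u (n - 1)" "1 \<le> u n"
    using n u unfolding U_words_iff by auto
  then show "reflect_last n (reflect_last n u) = u"
    "reflect_last n u (n - 1) + reflect_last n u n = Suc n - u n"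
    using n by (auto simp: reflect_last_def)
  show "reflect_last n u \<in> U_words n"
    unfolding U_words_iff
  proof (intro conjI ballI allI impI)
    fix i assume "i \<in> {2..n}"
    then show "reflect_last n u i + reflect_last n u (i - 1) \<le> i"
    proof (cases "i = n")
      case True
      then show ?thesis
        using n sum \<open>1 \<le> u n\<close> by (auto simp: reflect_last_def)
    qed (use u in \<open>auto simp: U_words_iff reflect_last_def\<close>)
  next
    fix i assume "i \<in> {1..n}"
    then show "1 \<le> reflect_last n u i"
      using sum U_words_pos[OF u, of i] by (cases "i = n") (auto simp: reflect_last_def)
  qed (use u n in \<open>auto simp: U_words_iff reflect_last_def\<close>)
qed

text \<open>The prescribed sum forces the last letter to be \<open>k - u n\<close>. It is positive
  precisely when \<open>u n < k\<close>, and the constraint at position \<open>Suc n\<close> reads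
  \<open>k \<le> Suc n\<close>.\<close>

lemma card_U_words_last_sum:
  assumes n: "1 \<le> n" and k: "k \<le> Suc n"
  shows "card {u \<in> U_words (Suc n). u n + u (Suc n) = k} = card {u \<in> U_words n. u n < k}"
proof -
  \<comment> \<open>Words are extensional, so deleting a letter means resetting it to
    \<open>undefined\<close>.\<close>
  let ?f = "\<lambda>u. u(Suc n := undefined)" and ?g = "\<lambda>u. u(Suc n := k - u n)"
  let ?A = "{u \<in> U_words (Suc n). u n + u (Suc n) = k}" and ?B = "{u \<in> U_words n. u n < k}"
  have "bij_betw ?f ?A ?B"
  proof (rule bij_betw_byWitness[where f' = ?g])
    show "\<forall>u\<in>?A. ?g (?f u) = u" by auto
    show "\<forall>u\<in>?B. ?f (?g u) = u" by (auto simp: U_words_iff fun_eq_iff)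
    show "?f ` ?A \<subseteq> ?B"
    proof clarify
      fix u assume u: "u \<in> U_words (Suc n)"
      then have "1 \<le> u (Suc n)" by (rule U_words_pos) auto
      moreover have "?f u \<in> U_words n"
        using u n unfolding U_words_iff by auto
      ultimately show "?f u \<in> U_words n \<and> ?f u n < u n + u (Suc n)"
        by simp
    qed
    show "?g ` ?B \<subseteq> ?A"
    proof clarify
      fix u assume u: "u \<in> U_words n" and less: "u n < k"
      have "?g u \<in> U_words (Suc n)"
        unfolding U_words_iff
      proof (intro conjI ballI allI impI)
        fix i assume "i \<in> {2..Suc n}"
        then show "?g u i + ?g u (i - 1) \<le> i"
          using u k less unfolding U_words_iff by (cases "i = Suc n") auto
      next
        fix i assume "i \<in> {1..Suc n}"
        then show "1 \<le> ?g u i"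
          using u less unfolding U_words_iff by (cases "i = Suc n") auto
      qed (use u n in \<open>auto simp: U_words_iff\<close>)
      then show "?g u \<in> U_words (Suc n) \<and> ?g u n + ?g u (Suc n) = k"
        using less by simp
    qed
  qed
  then show ?thesis
    by (rule bij_betw_same_card)
qed

text \<open>After the last letter is deleted, the remaining condition \<open>u n < k\<close>
  concerns a letter, not a sum of two; the reflection turns it into a lower bound on
  \<open>u (n - 1) + u n\<close>.\<close>

lemma U_words_recurrence:
  assumes n: "2 \<le> n" and k: "1 \<le> k" "k \<le> Suc n"
  shows "card {u \<in> U_words (Suc n). u n + u (Suc n) = k} =
    (\<Sum>j\<in>{Suc n - k<..n}. card {u \<in> U_words n. u (n - 1) + u n = j})"
proof -
  have le: "u (n - 1) + u n \<le> n" "1 \<le> u n" "1 \<le> u (n - 1)" if "u \<in> U_words n" for u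
    using that n by (auto simp: U_words_iff add.commute)
  have "bij_betw (reflect_last n) {u \<in> U_words n. u n < k}
      {u \<in> U_words n. Suc n - k < u (n - 1) + u n}"
  proof (rule bij_betw_byWitness[where f' = "reflect_last n"])
    show "reflect_last n ` {u \<in> U_words n. u n < k}
        \<subseteq> {u \<in> U_words n. Suc n - k < u (n - 1) + u n}"
      using reflect_last_U_words[OF n] k by auto
    show "reflect_last n ` {u \<in> U_words n. Suc n - k < u (n - 1) + u n}
        \<subseteq> {u \<in> U_words n. u n < k}"
    proof clarify
      fix u assume "u \<in> U_words n" "Suc n - k < u (n - 1) + u n"
      then show "reflect_last n u \<in> U_words n \<and> reflect_last n u n < k"
        using reflect_last_U_words(1)[OF n] le[of u] by (auto simp: reflect_last_def)
    qed
  qed (use reflect_last_U_words[OF n] in auto)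
  then have "card {u \<in> U_words n. u n < k} = card {u \<in> U_words n. Suc n - k < u (n - 1) + u n}"
    by (rule bij_betw_same_card)
  also have "\<dots> = (\<Sum>j\<in>{Suc n - k<..n}. card {u \<in> U_words n. u (n - 1) + u n = j})"
    by (intro card_greater_conv_sum finite_U_words le)
  finally show ?thesis
    using n k by (simp add: card_U_words_last_sum)
qed

section \<open>Initial values and the induction\<close>

lemma entringer_1: "entringer 1 1 = 1"
proof -
  have "{\<pi>. \<pi> permutes {1..1} \<and> down_up 1 \<pi> \<and> \<pi> 1 = 1} = {id :: nat \<Rightarrow> nat}"
    by (auto simp: down_up_def)
  then show ?thesis by (simp add: entringer_def)
qed

lemma U_words_1: "U_words 1 = {\<lambda>i. if i = 1 then 1 else undefined}"
  by (auto simp: U_words_iff fun_eq_iff)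

theorem theorem12:
  fixes n k :: nat
  assumes "n \<ge> 2" and "1 \<le> k" and "k \<le> n"
  shows "card {u \<in> U_words n. u (n - 1) + u n = k} = entringer n k"
  using assms
proof (induction n arbitrary: k rule: nat_induct_at_least)
  case base
  \<comment> \<open>The recurrence for words starts only at length 2, since the statistic needs two
    letters. Length 2 is therefore reduced directly to the single word of length 1.\<close>
  have "card {u \<in> U_words 2. u 1 + u 2 = k} = card {u \<in> U_words 1. u 1 < k}"
    using card_U_words_last_sum[of 1 k] base by (simp add: numeral_2_eq_2)
  also have "\<dots> = entringer 2 k"
  proof (cases "k = 1")
    \<comment> \<open>Both sides vanish: no letter is below 1, and the sum runs over the empty range
      \<open>{1<..1}\<close>.\<close>
    case True
    then show ?thesis
      using entringer_recurrence[of 1 k] by (simp add: U_words_1[simplified] numeral_2_eq_2)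
  next
    case False
    then have "k = 2" using base by simp
    moreover have "{u \<in> U_words 1. u 1 < 2} = {\<lambda>i. if i = 1 then 1 else undefined}"
      unfolding U_words_1 by auto
    moreover have "{Suc 1 - 2<..1} = {1 :: nat}" by auto
    ultimately show ?thesis
      using entringer_recurrence[of 1 2] entringer_1 by (simp add: numeral_2_eq_2)
  qed
  finally show ?case by simp
next
  case (Suc n)
  have "card {u \<in> U_words (Suc n). u n + u (Suc n) = k} =
      (\<Sum>j\<in>{Suc n - k<..n}. card {u \<in> U_words n. u (n - 1) + u n = j})"
    using Suc by (intro U_words_recurrence)
  \<comment> \<open>Every index \<open>j\<close> satisfies \<open>1 \<le> j\<close> and
    \<open>j \<le> n\<close>, so the induction hypothesis applies to each summand.\<close>
  also have "\<dots> = (\<Sum>j\<in>{Suc n - k<..n}. entringer n j)"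
    using Suc by (intro sum.cong) auto
  also have "\<dots> = entringer (Suc n) k"
    using Suc by (intro entringer_recurrence[symmetric]) auto
  finally show ?case by simp
qed

end
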